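(* Let $G$ be a finite group which is the internal central product $G = U_1U_2$ of subgroups $U_1, U_2 \leq G$. Let $D = U_1\times U_2$ be the external direct product with standard projections $\pi_i: D\to U_i$ ($i=1,2$), let $\overline{U}_1=\{(u_1,1) : u_1\in U_1\}$ and $\overline{U}_2=\{(1,u_2) : u_2\in U_2\}$, and let $\varepsilon : D \to G$ be an epimorphism with $\varepsilon(\overline{U}_i)=U_i$ for $i=1,2$. Let $H \leq G$, and suppose that $U_1$ or $U_2$ is solvable. Then the following are equivalent: (1) $H$ is abnormal in $G$. (2) $\varepsilon^{-1}(H)$ is abnormal in $D$. (3) With $K = \varepsilon^{-1}(H)$, $\pi_i(K)$ is abnormal in $U_i$ for $i=1,2$, and $K = \pi_1(K) \times \pi_2(K)$.
   Context: $G$ is an internal central product of subgroups $U_1,U_2\leq G$ if $G=U_1U_2$ and $[U_1,U_2]=1$. A subgroup $H\leq G$ is abnormal in $G$ if $g\in\langle H,H^{g}\rangle$ for all $g\in G$, where $H^g=g^{-1}Hg$. $\varepsilon^{-1}(H)$ is the full preimage of $H$. *)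

theory Defs
  imports "HOL-Algebra.Algebra"
begin

text \<open>The commutator subgroup \<open>[A, B]\<close>, with the convention \<open>[a, b] = a\<^sup>-\<^sup>1 b\<^sup>-\<^sup>1 a b\<close>.\<close>

definition commutator_subgroup :: "('a, 'b) monoid_scheme \<Rightarrow> 'a set \<Rightarrow> 'a set \<Rightarrow> 'a set" where
  "commutator_subgroup G A B =
     generate G {inv\<^bsub>G\<^esub> a \<otimes>\<^bsub>G\<^esub> inv\<^bsub>G\<^esub> b \<otimes>\<^bsub>G\<^esub> a \<otimes>\<^bsub>G\<^esub> b | a b. a \<in> A \<and> b \<in> B}"

definition internal_central_product ::
    "('a, 'b) monoid_scheme \<Rightarrow> 'a set \<Rightarrow> 'a set \<Rightarrow> bool" where
  "internal_central_product G U\<^sub>1 U\<^sub>2 \<longleftrightarrow>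
     subgroup U\<^sub>1 G \<and> subgroup U\<^sub>2 G \<and> carrier G = U\<^sub>1 <#>\<^bsub>G\<^esub> U\<^sub>2 \<and>
     commutator_subgroup G U\<^sub>1 U\<^sub>2 = {\<one>\<^bsub>G\<^esub>}"

definition conjugate_set :: "('a, 'b) monoid_scheme \<Rightarrow> 'a set \<Rightarrow> 'a \<Rightarrow> 'a set" where
  "conjugate_set G H g = (\<lambda>h. inv\<^bsub>G\<^esub> g \<otimes>\<^bsub>G\<^esub> h \<otimes>\<^bsub>G\<^esub> g) ` H"

definition abnormal :: "'a set \<Rightarrow> ('a, 'b) monoid_scheme \<Rightarrow> bool" where
  "abnormal H G \<longleftrightarrow>
     subgroup H G \<and> (\<forall>g \<in> carrier G. g \<in> generate G (H \<union> conjugate_set G H g))"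

end

theory Submission
  imports Defs
begin

text \<open>Abnormality passes to images and to full preimages under epimorphisms, which settles
  (1) \<open>\<longleftrightarrow>\<close> (2) and shows that the projections of an abnormal \<open>K \<le> U\<^sub>1 \<times> U\<^sub>2\<close> are abnormal.
  A product of abnormal subgroups is abnormal because \<open>(u, v) = (u, 1)(1, v)\<close>.
  For the decomposition of an abnormal \<open>K\<close>, say with \<open>U\<^sub>1\<close> solvable, put \<open>A = \<pi>\<^sub>1(K)\<close> and
  \<open>K\<^sub>1 = {a. (a, 1) \<in> K}\<close>, a normal subgroup of \<open>A\<close>. If \<open>f\<close> is a homomorphism from \<open>A\<close> to an
  abelian group, then the subgroup \<open>M = {(x, y). \<exists>(a, y) \<in> K. f x = f a}\<close> contains
  \<open>K\<close> and its conjugates by \<open>(x, 1)\<close> with \<open>x \<in> A\<close>, hence contains \<open>(x, 1)\<close> by abnormality;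
  so \<open>f(A) = f(K\<^sub>1)\<close>. Thus \<open>A/K\<^sub>1\<close> is perfect, and being solvable it is trivial. This means
  \<open>A \<times> 1 \<subseteq> K\<close>, and \<open>K\<close> is the product of its projections.\<close>

section \<open>Abnormality under homomorphisms: images and full preimages\<close>

lemma abnormal_subgroup: "abnormal H G \<Longrightarrow> subgroup H G"
  by (simp add: abnormal_def)

lemma abnormalD:
  "abnormal H G \<Longrightarrow> g \<in> carrier G \<Longrightarrow> g \<in> generate G (H \<union> conjugate_set G H g)"
  by (simp add: abnormal_def)

lemma (in group) conjugate_set_subset:
  assumes "H \<subseteq> carrier G" "g \<in> carrier G"
  shows "conjugate_set G H g \<subseteq> carrier G"
  using assms by (auto simp: conjugate_set_def)

lemma (in group_hom) conjugate_set_img: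
  assumes "K \<subseteq> carrier G" "g \<in> carrier G"
  shows "h ` conjugate_set G K g = conjugate_set H (h ` K) (h g)"
  unfolding conjugate_set_def image_image
  using assms by (intro image_cong refl) (auto simp: subset_iff)

text \<open>A homomorphism respects both conjugation and generation. This carries the abnormality
  condition at \<open>g\<close> to the one at \<open>h g\<close>, and it is used for images as well
  as for preimages.\<close>

lemma (in group_hom) generate_conjugate_img:
  assumes "K \<subseteq> carrier G" "g \<in> carrier G"
  shows "generate H (h ` K \<union> conjugate_set H (h ` K) (h g)) =
    h ` generate G (K \<union> conjugate_set G K g)"
  using assms generate_img[of "K \<union> conjugate_set G K g"]
  by (simp add: image_Un conjugate_set_img G.conjugate_set_subset)

lemma (in group_hom) abnormal_img:
  assumes "h ` carrier G = carrier H" "abnormal K G"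
  shows "abnormal (h ` K) H"
  unfolding abnormal_def
proof (intro conjI ballI)
  have K: "subgroup K G"
    using assms(2) by (rule abnormal_subgroup)
  then show "subgroup (h ` K) H"
    by (rule subgroup_img_is_subgroup)
  fix y assume "y \<in> carrier H"
  then obtain g where "g \<in> carrier G" "y = h g"
    using assms(1) by auto
  then show "y \<in> generate H (h ` K \<union> conjugate_set H (h ` K) y)"
    using generate_conjugate_img[OF subgroup.subset[OF K]] abnormalD[OF assms(2)] by auto
qed

lemma (in group_hom) subgroup_preimage:
  assumes "subgroup L H"
  shows "subgroup {x \<in> carrier G. h x \<in> L} G"
  using assms by (intro G.subgroupI) (auto simp: subgroup_def)

lemma (in group_hom) abnormal_preimage:
  assumes "h ` carrier G = carrier H" "abnormal L H"
  shows "abnormal {x \<in> carrier G. h x \<in> L} G"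
proof -
  define K where "K = {x \<in> carrier G. h x \<in> L}"
  have L: "subgroup L H"
    using assms(2) by (rule abnormal_subgroup)
  have K: "subgroup K G"
    unfolding K_def using L by (rule subgroup_preimage)
  have hK: "h ` K = L"
    using assms(1) subgroup.subset[OF L] by (auto simp: K_def)
  have "g \<in> generate G (K \<union> conjugate_set G K g)" (is "g \<in> ?S") if g: "g \<in> carrier G" for g
  proof -
    have S: "subgroup ?S G"
      using subgroup.subset[OF K] g by (intro G.generate_is_subgroup) (simp add: G.conjugate_set_subset)
    have "h g \<in> h ` ?S"
      using abnormalD[OF assms(2), of "h g"] generate_conjugate_img[OF subgroup.subset[OF K] g] g
      by (simp add: hK)
    then obtain s where s: "s \<in> ?S" "h g = h s"
      by auto
    have sG: "s \<in> carrier G"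
      using subgroup.mem_carrier[OF S s(1)] .
    \<comment> \<open>\<open>g\<close> and \<open>s\<close> have the same image, so they differ by
      an element of the kernel. A full preimage contains the kernel, which is why membership can be
      pulled back from \<open>H\<close> to \<open>G\<close>.\<close>
    have "g \<otimes> inv s \<in> K"
      using g sG s(2) subgroup.one_closed[OF L] by (simp add: K_def)
    then have "g \<otimes> inv s \<in> ?S"
      by (intro generate.incl) simp
    then have "g \<otimes> inv s \<otimes> s \<in> ?S"
      using s(1) by (rule subgroup.m_closed[OF S])
    then show ?thesis
      using g sG by (simp add: G.m_assoc)
  qed
  then show ?thesis
    using K unfolding abnormal_def K_def by blast
qed

lemma (in group_hom) abnormal_preimage_iff:
  assumes "h ` carrier G = carrier H" "subgroup L H"
  shows "abnormal {x \<in> carrier G. h x \<in> L} G \<longleftrightarrow> abnormal L H"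
proof
  assume "abnormal {x \<in> carrier G. h x \<in> L} G"
  then have "abnormal (h ` {x \<in> carrier G. h x \<in> L}) H"
    by (rule abnormal_img[OF assms(1)])
  moreover have "h ` {x \<in> carrier G. h x \<in> L} = L"
    using assms(1) subgroup.subset[OF assms(2)] by auto
  ultimately show "abnormal L H"
    by simp
qed (rule abnormal_preimage[OF assms(1)])

section \<open>Abnormal subgroups of direct products: projections and products\<close>

lemma group_hom_fst: "group G \<Longrightarrow> group H \<Longrightarrow> group_hom (G \<times>\<times> H) G fst"
  by (auto simp: group_hom_def group_hom_axioms_def hom_def DirProd_group mult_DirProd')

lemma group_hom_snd: "group G \<Longrightarrow> group H \<Longrightarrow> group_hom (G \<times>\<times> H) H snd"
  by (auto simp: group_hom_def group_hom_axioms_def hom_def DirProd_group mult_DirProd')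

lemma group_hom_swap: "group G \<Longrightarrow> group H \<Longrightarrow> group_hom (G \<times>\<times> H) (H \<times>\<times> G) prod.swap"
  by (auto simp: group_hom_def group_hom_axioms_def hom_def DirProd_group)

lemma group_hom_Pair_one: "group G \<Longrightarrow> group H \<Longrightarrow> group_hom G (G \<times>\<times> H) (\<lambda>x. (x, \<one>\<^bsub>H\<^esub>))"
  by (auto simp: group_hom_def group_hom_axioms_def hom_def DirProd_group group.is_monoid)

lemma group_hom_one_Pair: "group G \<Longrightarrow> group H \<Longrightarrow> group_hom H (G \<times>\<times> H) (Pair \<one>\<^bsub>G\<^esub>)"
  by (auto simp: group_hom_def group_hom_axioms_def hom_def DirProd_group group.is_monoid)

lemma abnormal_fst:
  assumes "group G" "group H" "abnormal K (G \<times>\<times> H)"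
  shows "abnormal (fst ` K) G"
proof (rule group_hom.abnormal_img[OF group_hom_fst[OF assms(1,2)] _ assms(3)])
  show "fst ` carrier (G \<times>\<times> H) = carrier G"
    using monoid.one_closed[OF group.is_monoid[OF assms(2)]] by auto
qed

lemma abnormal_snd:
  assumes "group G" "group H" "abnormal K (G \<times>\<times> H)"
  shows "abnormal (snd ` K) H"
proof (rule group_hom.abnormal_img[OF group_hom_snd[OF assms(1,2)] _ assms(3)])
  show "snd ` carrier (G \<times>\<times> H) = carrier H"
    using monoid.one_closed[OF group.is_monoid[OF assms(1)]] by auto
qed

lemma abnormal_swap:
  assumes "group G" "group H" "abnormal K (G \<times>\<times> H)"
  shows "abnormal (prod.swap ` K) (H \<times>\<times> G)"
  using group_hom.abnormal_img[OF group_hom_swap[OF assms(1,2)] _ assms(3)] by (simp add: product_swap)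

lemma abnormal_Times:
  assumes "group G" "group H" "abnormal A G" "abnormal B H"
  shows "abnormal (A \<times> B) (G \<times>\<times> H)"
proof -
  interpret G: group G by fact
  interpret H: group H by fact
  interpret D: group "G \<times>\<times> H"
    by (rule DirProd_group) fact+
  have A: "subgroup A G" and B: "subgroup B H"
    using assms(3,4) by (simp_all add: abnormal_subgroup)
  have AB: "subgroup (A \<times> B) (G \<times>\<times> H)"
    by (rule DirProd_subgroups) (fact assms A B)+
  have "(u, v) \<in> generate (G \<times>\<times> H) (A \<times> B \<union> conjugate_set (G \<times>\<times> H) (A \<times> B) (u, v))"
    (is "_ \<in> generate _ ?X")
    if uv: "u \<in> carrier G" "v \<in> carrier H" for u v
  proof -
    have X: "?X \<subseteq> carrier (G \<times>\<times> H)"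
      using subgroup.subset[OF AB] uv D.conjugate_set_subset[OF subgroup.subset[OF AB], of "(u, v)"]
      by simp
    have conj: "(inv\<^bsub>G\<^esub> u \<otimes>\<^bsub>G\<^esub> a \<otimes>\<^bsub>G\<^esub> u, inv\<^bsub>H\<^esub> v \<otimes>\<^bsub>H\<^esub> b \<otimes>\<^bsub>H\<^esub> v) \<in> ?X"
      if "a \<in> A" "b \<in> B" for a b
    proof -
      have "(a, b) \<in> A \<times> B"
        using that by simp
      then show ?thesis
        unfolding conjugate_set_def using uv assms(1,2)
        by (intro UnI2 rev_image_eqI[of "(a, b)"]) simp_all
    qed
    \<comment> \<open>Taking \<open>b\<close> to be the identity in \<open>conj\<close> makes the
      second coordinate of the conjugate trivial. So the generators of the subgroup that contains
      \<open>u\<close> embed into \<open>?X\<close>, although the conjugation is by (u, v) and not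
      by (u, 1).\<close>
    have "(\<lambda>x. (x, \<one>\<^bsub>H\<^esub>)) ` (A \<union> conjugate_set G A u) \<subseteq> ?X"
      using conj[OF _ subgroup.one_closed[OF B]] uv subgroup.one_closed[OF B]
      by (auto simp: conjugate_set_def)
    moreover have "(u, \<one>\<^bsub>H\<^esub>) \<in> (\<lambda>x. (x, \<one>\<^bsub>H\<^esub>)) ` generate G (A \<union> conjugate_set G A u)"
      using abnormalD[OF assms(3)] uv by blast
    ultimately have u: "(u, \<one>\<^bsub>H\<^esub>) \<in> generate (G \<times>\<times> H) ?X"
      using group_hom.generate_img[OF group_hom_Pair_one[OF assms(1,2)], of "A \<union> conjugate_set G A u"]
        subgroup.subset[OF A] G.conjugate_set_subset[of A u] uv D.mono_generate
      by blast
    have "Pair \<one>\<^bsub>G\<^esub> ` (B \<union> conjugate_set H B v) \<subseteq> ?X"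
      using conj[OF subgroup.one_closed[OF A]] uv subgroup.one_closed[OF A]
      by (auto simp: conjugate_set_def)
    moreover have "(\<one>\<^bsub>G\<^esub>, v) \<in> Pair \<one>\<^bsub>G\<^esub> ` generate H (B \<union> conjugate_set H B v)"
      using abnormalD[OF assms(4)] uv by blast
    ultimately have v: "(\<one>\<^bsub>G\<^esub>, v) \<in> generate (G \<times>\<times> H) ?X"
      using group_hom.generate_img[OF group_hom_one_Pair[OF assms(1,2)], of "B \<union> conjugate_set H B v"]
        subgroup.subset[OF B] H.conjugate_set_subset[of B v] uv D.mono_generate
      by blast
    \<comment> \<open>The two embedded elements multiply to (u, v).\<close>
    show ?thesis
      using generate.eng[OF u v] uv by simp
  qed
  then show ?thesis
    using AB by (auto simp: abnormal_def)
qed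

section \<open>Splitting of an abnormal subgroup when a factor is solvable\<close>

lemma (in group) perfect_solvable_trivial:
  assumes "solvable G" "derived G (carrier G) = carrier G"
  shows "carrier G = {\<one>}"
proof -
  \<comment> \<open>The derived series never descends, yet solvability makes one of its terms
    trivial.\<close>
  have "(derived G ^^ n) (carrier G) = carrier G" for n
    using assms(2) by (induction n) auto
  then show ?thesis
    using assms(1) by (simp add: solvable_iff_trivial_derived_seq)
qed

lemma (in group) solvable_subgroup_carrier:
  assumes "subgroup A G" "solvable G"
  shows "solvable (G\<lparr>carrier := A\<rparr>)"
  using group_hom.inj_hom_imp_solvable[OF canonical_inj_is_hom[OF assms(1)] _ assms(2)] by simp

text \<open>This serves to show that the first projection of \<open>K\<close>, modulo its elements
  \<open>k\<close> with (k, 1) in \<open>K\<close>, has no nontrivial abelian quotient: if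
  \<open>f\<close> kills all such \<open>k\<close>, then \<open>f\<close> is trivial.\<close>

lemma abnormal_DirProd_comm_hom:
  assumes "group G" "group H" "abnormal K (G \<times>\<times> H)"
    and "comm_group C" "f \<in> hom (G\<lparr>carrier := fst ` K\<rparr>) C" "x \<in> fst ` K"
  obtains k where "(k, \<one>\<^bsub>H\<^esub>) \<in> K" "f k = f x"
proof -
  interpret G: group G by fact
  interpret H: group H by fact
  interpret C: comm_group C by fact
  interpret D: group "G \<times>\<times> H"
    by (rule DirProd_group) fact+
  define A where "A = fst ` K"
  have K: "subgroup K (G \<times>\<times> H)"
    using assms(3) by (rule abnormal_subgroup)
  have A: "subgroup A G"
    unfolding A_def using group_hom.subgroup_img_is_subgroup[OF group_hom_fst K] assms(1,2) .
  interpret f: group_hom "G\<lparr>carrier := A\<rparr>" C f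
    using assms(5) G.subgroup_imp_group[OF A] C.is_group
    by (simp add: group_hom_def group_hom_axioms_def A_def)
  have A_inv: "inv\<^bsub>G\<^esub> a \<in> A" and f_inv: "f (inv\<^bsub>G\<^esub> a) = inv\<^bsub>C\<^esub> f a" if "a \<in> A" for a
    using that subgroup.m_inv_closed[OF A] f.hom_inv[of a] G.m_inv_consistent[OF A] by auto
  have A_mult: "a \<otimes>\<^bsub>G\<^esub> b \<in> A" and f_mult: "f (a \<otimes>\<^bsub>G\<^esub> b) = f a \<otimes>\<^bsub>C\<^esub> f b"
    if "a \<in> A" "b \<in> A" for a b
    using that subgroup.m_closed[OF A] f.hom_mult[of a b] by auto
  have fC: "f a \<in> carrier C" if "a \<in> A" for a
    using that f.hom_closed by simp
  have KA: "a \<in> A" "a \<in> carrier G" "b \<in> carrier H" if "(a, b) \<in> K" for a b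
    using that subgroup.subset[OF K] by (force simp: A_def)+
  \<comment> \<open>\<open>M\<close> is the product of \<open>K\<close> with (ker f) x 1, the
    enlargement of \<open>K\<close> that no longer distinguishes first coordinates with the same
    value under \<open>f\<close>.\<close>
  define M where "M = {(u, y). u \<in> A \<and> (\<exists>a. (a, y) \<in> K \<and> f u = f a)}"
  have "K \<subseteq> M"
    using KA by (auto simp: M_def)
  have "x \<in> A"
    using assms(6) by (simp add: A_def)
  then have x: "x \<in> carrier G"
    by (rule subgroup.mem_carrier[OF A])
  have "subgroup M (G \<times>\<times> H)"
  proof (rule D.subgroupI)
    show "M \<subseteq> carrier (G \<times>\<times> H)"
      using KA subgroup.mem_carrier[OF A] by (auto simp: M_def)
    show "M \<noteq> {}"
      using \<open>K \<subseteq> M\<close> subgroup.one_closed[OF K] by blast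
  next
    fix p assume "p \<in> M"
    then obtain u y a where p: "p = (u, y)" "u \<in> A" "(a, y) \<in> K" "f u = f a"
      by (auto simp: M_def)
    have "(inv\<^bsub>G\<^esub> a, inv\<^bsub>H\<^esub> y) \<in> K"
      using subgroup.m_inv_closed[OF K p(3)] KA[OF p(3)] assms(1,2) by simp
    then show "inv\<^bsub>G \<times>\<times> H\<^esub> p \<in> M"
      using p KA[OF p(3)] subgroup.mem_carrier[OF A p(2)] assms(1,2) A_inv
      by (auto simp: M_def f_inv intro!: exI[of _ "inv\<^bsub>G\<^esub> a"])
  next
    fix p q assume "p \<in> M" "q \<in> M"
    then obtain u y a v z b where pq: "p = (u, y)" "u \<in> A" "(a, y) \<in> K" "f u = f a"
      "q = (v, z)" "v \<in> A" "(b, z) \<in> K" "f v = f b"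
      by (auto simp: M_def)
    have "(a \<otimes>\<^bsub>G\<^esub> b, y \<otimes>\<^bsub>H\<^esub> z) \<in> K"
      using subgroup.m_closed[OF K pq(3) pq(7)] by simp
    then show "p \<otimes>\<^bsub>G \<times>\<times> H\<^esub> q \<in> M"
      using pq KA(1)[OF pq(3)] KA(1)[OF pq(7)] A_mult
      by (auto simp: M_def f_mult intro!: exI[of _ "a \<otimes>\<^bsub>G\<^esub> b"])
  qed
  \<comment> \<open>Conjugation by (x, 1) leaves the second coordinate alone. It also keeps the
    value of \<open>f\<close> on the first one, because \<open>C\<close> is commutative.\<close>
  moreover have "conjugate_set (G \<times>\<times> H) K (x, \<one>\<^bsub>H\<^esub>) \<subseteq> M"
  proof
    fix p assume "p \<in> conjugate_set (G \<times>\<times> H) K (x, \<one>\<^bsub>H\<^esub>)"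
    then obtain a y where ay: "(a, y) \<in> K" and
      p: "p = inv\<^bsub>G \<times>\<times> H\<^esub> (x, \<one>\<^bsub>H\<^esub>) \<otimes>\<^bsub>G \<times>\<times> H\<^esub> (a, y) \<otimes>\<^bsub>G \<times>\<times> H\<^esub> (x, \<one>\<^bsub>H\<^esub>)"
      by (auto simp: conjugate_set_def)
    have "p = (inv\<^bsub>G\<^esub> x \<otimes>\<^bsub>G\<^esub> a \<otimes>\<^bsub>G\<^esub> x, y)"
      using p x assms(1,2) KA[OF ay] by simp
    moreover have "f (inv\<^bsub>G\<^esub> x \<otimes>\<^bsub>G\<^esub> a \<otimes>\<^bsub>G\<^esub> x) = inv\<^bsub>C\<^esub> f x \<otimes>\<^bsub>C\<^esub> (f x \<otimes>\<^bsub>C\<^esub> f a)"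
      using \<open>x \<in> A\<close> KA(1)[OF ay] A_inv A_mult
      by (simp add: f_mult f_inv fC C.m_assoc C.m_comm[of "f a"])
    moreover have "\<dots> = f a"
      using \<open>x \<in> A\<close> KA(1)[OF ay] by (simp add: fC C.m_assoc[symmetric])
    ultimately show "p \<in> M"
      using ay \<open>x \<in> A\<close> KA(1)[OF ay] A_inv A_mult by (auto simp: M_def)
  qed
  ultimately have "generate (G \<times>\<times> H) (K \<union> conjugate_set (G \<times>\<times> H) K (x, \<one>\<^bsub>H\<^esub>)) \<subseteq> M"
    using \<open>K \<subseteq> M\<close> by (intro D.generate_subgroup_incl) simp_all
  \<comment> \<open>Abnormality is applied at (x, 1) only. Unfolding \<open>M\<close> at this
    element yields the required \<open>k\<close>.\<close>
  then have "(x, \<one>\<^bsub>H\<^esub>) \<in> M"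
    using abnormalD[OF assms(3), of "(x, \<one>\<^bsub>H\<^esub>)"] x by auto
  then show ?thesis
    using that by (auto simp: M_def)
qed

text \<open>\<open>K\<close> is the full product as soon as \<open>N\<close> exhausts the first
  projection \<open>A\<close>. So the work is to show that the quotient \<open>Q\<close> of
  \<open>A\<close> by \<open>N\<close> is trivial, which follows once it is both solvable and equal
  to its derived subgroup.\<close>

lemma abnormal_DirProd_solvable_left:
  assumes "group G" "group H" "abnormal K (G \<times>\<times> H)" "solvable G"
  shows "K = fst ` K \<times> snd ` K"
proof -
  interpret G: group G by fact
  interpret H: group H by fact
  define A where "A = fst ` K"
  define N where "N = {a. (a, \<one>\<^bsub>H\<^esub>) \<in> K}"
  have K: "subgroup K (G \<times>\<times> H)"
    using assms(3) by (rule abnormal_subgroup)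
  have KG: "a \<in> carrier G" "b \<in> carrier H" if "(a, b) \<in> K" for a b
    using that subgroup.subset[OF K] by auto
  have K_mult: "(a \<otimes>\<^bsub>G\<^esub> c, b \<otimes>\<^bsub>H\<^esub> d) \<in> K" if "(a, b) \<in> K" "(c, d) \<in> K" for a b c d
    using subgroup.m_closed[OF K that] by simp
  have K_inv: "(inv\<^bsub>G\<^esub> a, inv\<^bsub>H\<^esub> b) \<in> K" if "(a, b) \<in> K" for a b
    using subgroup.m_inv_closed[OF K that] KG[OF that] assms(1,2) by simp
  have A: "subgroup A G"
    unfolding A_def using group_hom.subgroup_img_is_subgroup[OF group_hom_fst K] assms(1,2) .
  interpret A: group "G\<lparr>carrier := A\<rparr>"
    using A by (rule G.subgroup_imp_group)
  have NA: "N \<subseteq> A"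
    by (force simp: N_def A_def)
  interpret N: normal N "G\<lparr>carrier := A\<rparr>"
  proof (rule A.normal_invI)
    have "subgroup N G"
    proof (rule G.subgroupI)
      show "N \<subseteq> carrier G"
        using KG by (auto simp: N_def)
      show "N \<noteq> {}"
        using subgroup.one_closed[OF K] by (auto simp: N_def)
      show "inv\<^bsub>G\<^esub> a \<in> N" if "a \<in> N" for a
        using that K_inv[of a "\<one>\<^bsub>H\<^esub>"] by (simp add: N_def)
      show "a \<otimes>\<^bsub>G\<^esub> b \<in> N" if "a \<in> N" "b \<in> N" for a b
        using that K_mult[of a "\<one>\<^bsub>H\<^esub>" b "\<one>\<^bsub>H\<^esub>"] by (simp add: N_def)
    qed
    then show "subgroup N (G\<lparr>carrier := A\<rparr>)"
      using A NA by (intro G.subgroup_incl)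
  next
    \<comment> \<open>Each \<open>x\<close> in \<open>A\<close> has a partner \<open>y\<close> with
      (x, y) in \<open>K\<close>. Conjugating (n, 1) by this pair stays in \<open>K\<close> and
      leaves the second coordinate trivial.\<close>
    fix x n assume "x \<in> carrier (G\<lparr>carrier := A\<rparr>)" "n \<in> N"
    then obtain y where xy: "(x, y) \<in> K" and n: "(n, \<one>\<^bsub>H\<^esub>) \<in> K"
      by (auto simp: A_def N_def)
    have "x \<in> A"
      using xy by (force simp: A_def)
    have "(x \<otimes>\<^bsub>G\<^esub> n \<otimes>\<^bsub>G\<^esub> inv\<^bsub>G\<^esub> x, y \<otimes>\<^bsub>H\<^esub> \<one>\<^bsub>H\<^esub> \<otimes>\<^bsub>H\<^esub> inv\<^bsub>H\<^esub> y) \<in> K"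
      by (intro K_mult K_inv xy n)
    then show "x \<otimes>\<^bsub>G\<lparr>carrier := A\<rparr>\<^esub> n \<otimes>\<^bsub>G\<lparr>carrier := A\<rparr>\<^esub> inv\<^bsub>G\<lparr>carrier := A\<rparr>\<^esub> x \<in> N"
      using KG[OF xy] G.m_inv_consistent[OF A \<open>x \<in> A\<close>] by (simp add: N_def)
  qed
  define Q where "Q = G\<lparr>carrier := A\<rparr> Mod N"
  define q where "q = (\<lambda>a. N #>\<^bsub>G\<lparr>carrier := A\<rparr>\<^esub> a)"
  interpret Q: group Q
    unfolding Q_def by (rule N.factorgroup_is_group)
  have q: "q \<in> hom (G\<lparr>carrier := A\<rparr>) Q"
    unfolding q_def Q_def by (rule N.r_coset_hom_Mod)
  interpret q: group_hom "G\<lparr>carrier := A\<rparr>" Q q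
    using q A.is_group Q.is_group by (simp add: group_hom_def group_hom_axioms_def)
  have surj: "q ` A = carrier Q"
    by (auto simp: q_def Q_def FactGroup_def RCOSETS_def)
  \<comment> \<open>The kernel of \<open>q\<close> is \<open>N\<close>.\<close>
  have q_one: "q a = \<one>\<^bsub>Q\<^esub> \<longleftrightarrow> a \<in> N" if "a \<in> A" for a
    using that A.coset_join1[OF _ _ N.subgroup_axioms, of a] A.coset_join2[OF _ N.subgroup_axioms, of a]
      N.subset by (auto simp: q_def Q_def FactGroup_def)
  define P where "P = derived Q (carrier Q)"
  interpret P: normal P Q
    unfolding P_def by (rule Q.derived_self_is_normal)
  have r: "(\<lambda>z. P #>\<^bsub>Q\<^esub> z) \<in> hom Q (Q Mod P)"
    by (rule P.r_coset_hom_Mod)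
  have "carrier Q \<subseteq> P"
  proof
    fix z assume z: "z \<in> carrier Q"
    then obtain x where x: "x \<in> A" "z = q x"
      using surj by auto
    \<comment> \<open>The abelian group to which the previous lemma is applied is the abelianization
      of \<open>Q\<close>. The \<open>k\<close> it provides lies in \<open>N\<close>, so
      \<open>q k\<close> is trivial and the coset of \<open>z\<close> is \<open>P\<close>
      itself.\<close>
    have "(\<lambda>z. P #>\<^bsub>Q\<^esub> z) \<circ> q \<in> hom (G\<lparr>carrier := fst ` K\<rparr>) (Q Mod P)"
      using Group.hom_compose[OF q r] by (simp add: A_def)
    moreover have "comm_group (Q Mod P)"
      unfolding P_def by (rule Q.derived_quot_is_comm_group)
    ultimately obtain k where "(k, \<one>\<^bsub>H\<^esub>) \<in> K" "P #>\<^bsub>Q\<^esub> q k = P #>\<^bsub>Q\<^esub> q x"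
      using x abnormal_DirProd_comm_hom[OF assms(1-3), of "Q Mod P" "(\<lambda>z. P #>\<^bsub>Q\<^esub> z) \<circ> q" x]
      unfolding A_def comp_def by blast
    moreover from this have "q k = \<one>\<^bsub>Q\<^esub>"
      using NA q_one by (auto simp: N_def)
    ultimately have "P #>\<^bsub>Q\<^esub> z = P"
      using x(2) Q.coset_mult_one[OF P.subset] by simp
    then show "z \<in> P"
      using Q.coset_join1[OF _ z P.subgroup_axioms] by simp
  qed
  \<comment> \<open>Solvability descends from \<open>G\<close> to the subgroup \<open>A\<close> and
    then to its image \<open>Q\<close>.\<close>
  moreover have "solvable Q"
    using q.surj_hom_imp_solvable G.solvable_subgroup_carrier[OF A assms(4)] surj by simp
  ultimately have Q: "carrier Q = {\<one>\<^bsub>Q\<^esub>}"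
    using P.subset by (intro Q.perfect_solvable_trivial) (auto simp: P_def)
  have AN: "A \<subseteq> N"
  proof
    fix a assume "a \<in> A"
    moreover from this have "q a \<in> carrier Q"
      unfolding surj[symmetric] by (rule imageI)
    ultimately show "a \<in> N"
      using q_one Q by simp
  qed
  have "fst ` K \<times> snd ` K \<subseteq> K"
  proof clarsimp
    fix a b c d assume ab: "(a, b) \<in> K" and cd: "(c, d) \<in> K"
    \<comment> \<open>This quotient is chosen so that multiplying (c, d) by it in the first
      coordinate replaces \<open>c\<close> by \<open>a\<close> without leaving
      \<open>K\<close>.\<close>
    then have "a \<otimes>\<^bsub>G\<^esub> inv\<^bsub>G\<^esub> c \<in> N"
      using AN subgroup.m_closed[OF A] subgroup.m_inv_closed[OF A]
      by (metis A_def fst_conv imageI subsetD)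
    then have "(a \<otimes>\<^bsub>G\<^esub> inv\<^bsub>G\<^esub> c \<otimes>\<^bsub>G\<^esub> c, \<one>\<^bsub>H\<^esub> \<otimes>\<^bsub>H\<^esub> d) \<in> K"
      using cd by (intro K_mult) (simp_all add: N_def)
    then show "(a, d) \<in> K"
      using KG[OF ab] KG[OF cd] by (simp add: G.m_assoc)
  qed
  moreover have "K \<subseteq> fst ` K \<times> snd ` K"
    by (rule subset_fst_snd)
  ultimately show ?thesis
    by (intro equalityI)
qed

lemma abnormal_DirProd_solvable:
  assumes "group G" "group H" "abnormal K (G \<times>\<times> H)" "solvable G \<or> solvable H"
  shows "K = fst ` K \<times> snd ` K"
  using assms(4)
proof
  assume "solvable H"
  \<comment> \<open>Exchanging the factors reduces to the case of a solvable left factor; applying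
    the exchange again returns to \<open>K\<close>.\<close>
  then have "prod.swap ` K = fst ` prod.swap ` K \<times> snd ` prod.swap ` K"
    using assms(1-3) by (intro abnormal_DirProd_solvable_left[of H G] abnormal_swap)
  then have "prod.swap ` prod.swap ` K = prod.swap ` (snd ` K \<times> fst ` K)"
    by (simp add: image_image)
  then show ?thesis
    by (simp add: image_image product_swap)
qed (rule abnormal_DirProd_solvable_left[OF assms(1-3)])

lemma abnormal_DirProd_iff:
  assumes "group G" "group H" "solvable G \<or> solvable H"
  shows "abnormal K (G \<times>\<times> H) \<longleftrightarrow>
    abnormal (fst ` K) G \<and> abnormal (snd ` K) H \<and> K = fst ` K \<times> snd ` K"
proof
  assume K: "abnormal K (G \<times>\<times> H)"
  show "abnormal (fst ` K) G \<and> abnormal (snd ` K) H \<and> K = fst ` K \<times> snd ` K"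
    by (intro conjI abnormal_fst[OF assms(1,2) K] abnormal_snd[OF assms(1,2) K]
        abnormal_DirProd_solvable[OF assms(1,2) K assms(3)])
next
  assume R: "abnormal (fst ` K) G \<and> abnormal (snd ` K) H \<and> K = fst ` K \<times> snd ` K"
  then have "abnormal (fst ` K \<times> snd ` K) (G \<times>\<times> H)"
    by (intro abnormal_Times assms(1,2)) simp_all
  with R show "abnormal K (G \<times>\<times> H)"
    by simp
qed

theorem theorem6p7:
  fixes G :: "('a, 'b) monoid_scheme"
    and U\<^sub>1 U\<^sub>2 H :: "'a set"
    and D :: "('a \<times> 'a) monoid"
    and \<epsilon> :: "'a \<times> 'a \<Rightarrow> 'a"
    and K :: "('a \<times> 'a) set"
  assumes "group G" and "finite (carrier G)"
    and "internal_central_product G U\<^sub>1 U\<^sub>2"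
    and "D = (G\<lparr>carrier := U\<^sub>1\<rparr>) \<times>\<times> (G\<lparr>carrier := U\<^sub>2\<rparr>)"
    and "\<epsilon> \<in> epi D G"
    and "\<epsilon> ` (U\<^sub>1 \<times> {\<one>\<^bsub>G\<^esub>}) = U\<^sub>1"
    and "\<epsilon> ` ({\<one>\<^bsub>G\<^esub>} \<times> U\<^sub>2) = U\<^sub>2"
    and "subgroup H G"
    and "solvable (G\<lparr>carrier := U\<^sub>1\<rparr>) \<or> solvable (G\<lparr>carrier := U\<^sub>2\<rparr>)"
    and "K = {x \<in> carrier D. \<epsilon> x \<in> H}"
  shows "(abnormal H G \<longleftrightarrow> abnormal K D) \<and>
         (abnormal K D \<longleftrightarrow>
            abnormal (fst ` K) (G\<lparr>carrier := U\<^sub>1\<rparr>) \<and>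
            abnormal (snd ` K) (G\<lparr>carrier := U\<^sub>2\<rparr>) \<and>
            K = fst ` K \<times> snd ` K)"
proof -
  interpret G: group G by fact
  let ?U\<^sub>1 = "G\<lparr>carrier := U\<^sub>1\<rparr>" and ?U\<^sub>2 = "G\<lparr>carrier := U\<^sub>2\<rparr>"
  have U: "group ?U\<^sub>1" "group ?U\<^sub>2"
    using assms(3) by (auto simp: internal_central_product_def intro: G.subgroup_imp_group)
  interpret \<epsilon>: group_hom D G \<epsilon>
    using assms(1,4,5) DirProd_group[OF U] by (simp add: group_hom_def group_hom_axioms_def epi_def)
  \<comment> \<open>\<open>K\<close> is the full preimage of \<open>H\<close> under an epimorphism,
    so the transfer of abnormality works in both directions.\<close>
  have "abnormal H G \<longleftrightarrow> abnormal K D"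
    unfolding assms(10) using assms(5,8)
    by (intro \<epsilon>.abnormal_preimage_iff[symmetric]) (auto simp: epi_def)
  moreover have "abnormal K D \<longleftrightarrow>
      abnormal (fst ` K) ?U\<^sub>1 \<and> abnormal (snd ` K) ?U\<^sub>2 \<and> K = fst ` K \<times> snd ` K"
    unfolding assms(4) using U assms(9) by (rule abnormal_DirProd_iff)
  ultimately show ?thesis
    by (rule conjI)
qed

end
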